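(* Assume that $\mathcal{M}$ is locally linearizable in $v\in\mathcal{M}$. Then $\mathfrak{K}^{\mathrm{loc}}_{\mathcal{M},v}=\mathfrak{K}_{\mathbb{T}_v\mathcal{M}}$.
   Context: Let $\rho$ be a probability measure on $Y$, $\mathcal{V}=L^2(Y,\rho)$ (real-valued functions), $\|\cdot\|=\|\cdot\|_{L^2(Y,\rho)}$. Let $w\ge0$ be a weight function with $\int_Y w^{-1}\,d\rho=1$, let $\|v\|_{w,\infty}:=\operatorname{ess\,sup}_{y}\sqrt{w(y)}|v(y)|$, $\mathcal{V}_{w,\infty}:=\{v\in\mathcal{V}:\|v\|_{w,\infty}<\infty\}$, and let $\mathcal{V}_{w^2,\infty}$ be normed by $\operatorname{ess\,sup}_y w(y)|v(y)|$. For a set $A\subseteq\mathcal{V}$ put $U(A):=\{u/\|u\|:u\in A\setminus\{0\}\}$ and define the variation function $\mathfrak{K}_A(y):=\sup_{a\in U(A)}|a(y)|^2$. $B(v,r)=\{x:\|v-x\|\le r\}$. The model class $\mathcal{M}$ is called locally linearizable in $v\in\mathcal{M}$ if, for sufficiently small $r>0$, the set $\mathcal{M}\cap B(v,r)$ is an embedded, differentiable submanifold of a Euclidean space (here: a finite-dimensional linear subspace of $\mathcal{V}_{w,\infty}$ equipped with $\|\cdot\|$) with positive reach. The reach $\operatorname{rch}(\mathcal{N})$ of a set $\mathcal{N}$ is the largest number such that any point at distance less than $\operatorname{rch}(\mathcal{N})$ from $\mathcal{N}$ has a unique nearest point in $\mathcal{N}$. $\mathbb{T}_v\mathcal{M}$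 is the tangent space of $\mathcal{M}$ at $v$, regarded as a linear subspace of the ambient space. The local variation function is $\mathfrak{K}^{\mathrm{loc}}_{\mathcal{M},v}:=\lim_{r\to0}\mathfrak{K}_{\{v\}-\mathcal{M}\cap B(v,r)}$ (limit in $\mathcal{V}_{w^2,\infty}$), where $\{v\}-\mathcal{M}\cap B(v,r)=\{v-x:x\in\mathcal{M},\ \|v-x\|\le r\}$. *)

theory Defs
  imports "HOL-Probability.Probability"
begin

text \<open>
  The elements of L2 are honest functions rather than classes modulo null sets, because the
  variation function below evaluates them at points.  Consequently a model class is a set of
  functions that need not be closed under almost everywhere equality.
\<close>

definition L2 :: "'y measure \<Rightarrow> ('y \<Rightarrow> real) set" where
  "L2 \<rho> = {f \<in> borel_measurable \<rho>. integrable \<rho> (\<lambda>y. (f y)\<^sup>2)}"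

definition L2_norm :: "'y measure \<Rightarrow> ('y \<Rightarrow> real) \<Rightarrow> real" where
  "L2_norm \<rho> f = sqrt (\<integral>y. (f y)\<^sup>2 \<partial>\<rho>)"

definition wsup_norm :: "'y measure \<Rightarrow> ('y \<Rightarrow> real) \<Rightarrow> ('y \<Rightarrow> real) \<Rightarrow> ennreal" where
  "wsup_norm \<rho> w f = esssup \<rho> (\<lambda>y. ennreal (sqrt (w y) * \<bar>f y\<bar>))"

definition L2_wsup :: "'y measure \<Rightarrow> ('y \<Rightarrow> real) \<Rightarrow> ('y \<Rightarrow> real) set" where
  "L2_wsup \<rho> w = {f \<in> L2 \<rho>. wsup_norm \<rho> w f < \<infinity>}"

definition weight_function :: "'y measure \<Rightarrow> ('y \<Rightarrow> real) \<Rightarrow> bool" where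
  "weight_function \<rho> w \<longleftrightarrow> w \<in> borel_measurable \<rho> \<and> (\<forall>y\<in>space \<rho>. 0 \<le> w y) \<and>
     (\<integral>\<^sup>+y. inverse (ennreal (w y)) \<partial>\<rho>) = 1"


text \<open>Division by the norm excludes exactly the functions representing 0 in L2.\<close>

definition normalized :: "'y measure \<Rightarrow> ('y \<Rightarrow> real) set \<Rightarrow> ('y \<Rightarrow> real) set" where
  "normalized \<rho> A = {(\<lambda>y. u y / L2_norm \<rho> u) | u. u \<in> A \<and> L2_norm \<rho> u \<noteq> 0}"

text \<open>With values in \<^typ>\<open>ennreal\<close>, an unbounded supremum is infinite and the empty one is 0.\<close>

definition variation :: "'y measure \<Rightarrow> ('y \<Rightarrow> real) set \<Rightarrow> 'y \<Rightarrow> ennreal" where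
  "variation \<rho> A y = (SUP a\<in>normalized \<rho> A. ennreal (\<bar>a y\<bar>\<^sup>2))"

definition model_ball ::
    "'y measure \<Rightarrow> ('y \<Rightarrow> real) set \<Rightarrow> ('y \<Rightarrow> real) \<Rightarrow> real \<Rightarrow> ('y \<Rightarrow> real) set" where
  "model_ball \<rho> M v r = {x \<in> M. L2_norm \<rho> (\<lambda>y. v y - x y) \<le> r}"

definition ball_variation ::
    "'y measure \<Rightarrow> ('y \<Rightarrow> real) set \<Rightarrow> ('y \<Rightarrow> real) \<Rightarrow> real \<Rightarrow> 'y \<Rightarrow> ennreal" where
  "ball_variation \<rho> M v r = variation \<rho> ((\<lambda>x y. v y - x y) ` model_ball \<rho> M v r)"

text \<open>
  The space with weight \<open>w\<^sup>2\<close> in which the variation functions live.  No square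
  integrability is imposed: for instance, the variation function of the line spanned by
  \<open>1 / sqrt w\<close> is \<open>1 / w\<close>, which is only known to be integrable.
\<close>

definition in_wsup2 :: "'y measure \<Rightarrow> ('y \<Rightarrow> real) \<Rightarrow> ('y \<Rightarrow> ennreal) \<Rightarrow> bool" where
  "in_wsup2 \<rho> w K \<longleftrightarrow> K \<in> borel_measurable \<rho> \<and> (AE y in \<rho>. K y < \<infinity>) \<and>
     wsup_norm \<rho> (\<lambda>y. (w y)\<^sup>2) (\<lambda>y. enn2real (K y)) < \<infinity>"

text \<open>\<open>has_local_variation \<rho> w M v K\<close>: the local variation function of \<open>M\<close> at \<open>v\<close> exists and is \<open>K\<close>.\<close>

definition has_local_variation ::
    "'y measure \<Rightarrow> ('y \<Rightarrow> real) \<Rightarrow> ('y \<Rightarrow> real) set \<Rightarrow> ('y \<Rightarrow> real) \<Rightarrow> ('y \<Rightarrow> ennreal) \<Rightarrow> bool" where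
  "has_local_variation \<rho> w M v K \<longleftrightarrow>
     in_wsup2 \<rho> w K \<and>
     (\<forall>\<^sub>F r in at_right 0. in_wsup2 \<rho> w (ball_variation \<rho> M v r)) \<and>
     ((\<lambda>r. wsup_norm \<rho> (\<lambda>y. (w y)\<^sup>2)
              (\<lambda>y. enn2real (ball_variation \<rho> M v r y) - enn2real (K y))) \<longlongrightarrow> 0) (at_right 0)"


definition C1_on :: "('a::euclidean_space \<Rightarrow> 'b::euclidean_space) \<Rightarrow> 'a set \<Rightarrow> bool" where
  "C1_on f S \<longleftrightarrow> (\<exists>f' :: 'a \<Rightarrow> 'a \<Rightarrow>\<^sub>L 'b.
     (\<forall>x\<in>S. (f has_derivative blinfun_apply (f' x)) (at x)) \<and> continuous_on S f')"

definition C1_diffeomorphism ::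
    "'a::euclidean_space set \<Rightarrow> 'a set \<Rightarrow> ('a \<Rightarrow> 'a) \<Rightarrow> ('a \<Rightarrow> 'a) \<Rightarrow> bool" where
  "C1_diffeomorphism X W \<Phi> \<Psi> \<longleftrightarrow>
     open X \<and> open W \<and> homeomorphism X W \<Phi> \<Psi> \<and> C1_on \<Phi> X \<and> C1_on \<Psi> W"

text \<open>
  Embedded submanifold of class C1, possibly with boundary: locally a diffeomorphism of the
  ambient space flattens it to a linear subspace or to a closed half of one.  Boundary has to be
  allowed since the definition is applied to intersections with closed balls.
\<close>

definition embedded_submanifold :: "'a::euclidean_space set \<Rightarrow> bool" where
  "embedded_submanifold N \<longleftrightarrow> (\<exists>k::nat. \<forall>x\<in>N. \<exists>X W \<Phi> \<Psi> L.
     x \<in> X \<and> C1_diffeomorphism X W \<Phi> \<Psi> \<and> subspace L \<and> dim L = k \<and>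
     (\<Phi> ` (N \<inter> X) = W \<inter> L \<or>
      (\<exists>n\<in>L. n \<noteq> 0 \<and> \<Phi> ` (N \<inter> X) = W \<inter> {z \<in> L. 0 \<le> n \<bullet> z})))"

definition reach :: "'a::euclidean_space set \<Rightarrow> ereal" where
  "reach N = Sup {R. \<forall>p. ereal (infdist p N) < R \<longrightarrow> (\<exists>!q. q \<in> N \<and> dist p q = infdist p N)}"

text \<open>
  Velocities of curves in \<open>N\<close> emanating from or ending in \<open>x\<close>.  One-sided curves in both time
  directions make this the full linear tangent space also at a boundary point.
\<close>

definition tangent_space :: "'a::euclidean_space set \<Rightarrow> 'a \<Rightarrow> 'a set" where
  "tangent_space N x = {u. \<exists>\<gamma> e. 0 < (e::real) \<and> \<gamma> 0 = x \<and>
     (\<exists>I. (I = {0..<e} \<or> I = {-e<..0}) \<and> \<gamma> ` I \<subseteq> N \<and>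
          (\<gamma> has_vector_derivative u) (at 0 within I))}"


text \<open>
  A finite-dimensional linear subspace of \<^term>\<open>L2_wsup \<rho> w\<close>, equipped with the L2 norm, is
  given as the range of a linear isometry \<open>\<iota>\<close> from a Euclidean space.
\<close>

definition L2_embedding ::
    "'y measure \<Rightarrow> ('y \<Rightarrow> real) \<Rightarrow> ('e::euclidean_space \<Rightarrow> 'y \<Rightarrow> real) \<Rightarrow> bool" where
  "L2_embedding \<rho> w \<iota> \<longleftrightarrow> (\<forall>y\<in>space \<rho>. linear (\<lambda>c. \<iota> c y)) \<and>
     range \<iota> \<subseteq> L2_wsup \<rho> w \<and> (\<forall>c. L2_norm \<rho> (\<iota> c) = norm c)"

definition locally_linearizable ::
    "'y measure \<Rightarrow> ('y \<Rightarrow> real) \<Rightarrow> ('e::euclidean_space \<Rightarrow> 'y \<Rightarrow> real) \<Rightarrow>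
     ('y \<Rightarrow> real) set \<Rightarrow> ('y \<Rightarrow> real) \<Rightarrow> bool" where
  "locally_linearizable \<rho> w \<iota> M v \<longleftrightarrow> L2_embedding \<rho> w \<iota> \<and>
     (\<forall>\<^sub>F r in at_right 0. model_ball \<rho> M v r \<subseteq> range \<iota> \<and>
        embedded_submanifold (\<iota> -` model_ball \<rho> M v r) \<and>
        0 < reach (\<iota> -` model_ball \<rho> M v r))"

definition model_tangent_space ::
    "('e::euclidean_space \<Rightarrow> 'y \<Rightarrow> real) \<Rightarrow> ('y \<Rightarrow> real) set \<Rightarrow> ('y \<Rightarrow> real) \<Rightarrow> ('y \<Rightarrow> real) set" where
  "model_tangent_space \<iota> M v = \<iota> ` tangent_space (\<iota> -` M) (inv \<iota> v)"

end

theory Submission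
  imports Defs
begin

text \<open>
  In the coordinates given by \<open>\<iota>\<close> the functions \<open>v - x\<close> become differences \<open>c0 - c\<close> with \<open>c\<close> in
  \<open>N = \<iota> -` M\<close>, and the variation function of a set depends only on the unit directions of its
  nonzero elements: it is the supremum over these directions \<open>d\<close> of the squared linear functional
  \<open>d \<mapsto> \<iota> d y\<close>.  So the secant directions of \<open>N\<close> at \<open>c0\<close> of length at most \<open>r\<close> have to be compared
  with the unit tangent vectors.

  For every \<open>r\<close>, each unit tangent vector is, up to sign, a limit of such secant directions, along
  the curve that defines it (\<open>tangent_direction_in_closure_secants\<close>).  A squared functional is even
  and continuous, so the variation of the tangent space is at most that of each ball.
  Conversely, a limit of secant directions along points of \<open>N\<close> tending to \<open>c0\<close> is a tangent
  vector, by linearization in a flattening chart (\<open>secant_limit_in_tangent_space\<close>).  Since the unit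
  sphere is compact, for small \<open>r\<close> all secant directions are uniformly \<open>\<epsilon>\<close>-close to unit tangent
  vectors (\<open>secants_near_tangent_directions\<close>).

  Finite dimension also gives one constant \<open>C\<close> with \<open>sqrt w \<bar>\<iota> d\<bar> \<le> C \<parallel>d\<parallel>\<close> almost everywhere,
  simultaneously for all \<open>d\<close>.  Hence \<open>w \<bar>(\<iota> d)\<^sup>2 - (\<iota> u)\<^sup>2\<bar> = (sqrt w \<bar>\<iota> (d - u)\<bar>) (sqrt w \<bar>\<iota> (d + u)\<bar>)\<close>
  is at most \<open>2 C\<^sup>2 \<epsilon>\<close> for unit vectors at distance \<open>\<epsilon>\<close>, which is the convergence claimed
  (\<open>weighted_sup_square_diff_le\<close>).
\<close>

section \<open>Tangent vectors and secant directions\<close>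

definition unit_directions :: "'a::real_normed_vector set \<Rightarrow> 'a set" where
  "unit_directions A = sgn ` (A - {0})"

lemma norm_unit_directions: "d \<in> unit_directions A \<Longrightarrow> norm d = 1"
  unfolding unit_directions_def by (elim imageE) (simp add: norm_sgn)

lemma tangent_spaceI:
  assumes "0 < e" "\<gamma> 0 = x" "I = {0..<e} \<or> I = {-e<..0}" "\<gamma> ` I \<subseteq> N"
    "(\<gamma> has_vector_derivative u) (at 0 within I)"
  shows "u \<in> tangent_space N x"
  unfolding tangent_space_def
  by (intro CollectI exI[of _ \<gamma>] exI[of _ e] exI[of _ I] conjI assms)

lemma tangent_space_mono: "N \<subseteq> N' \<Longrightarrow> tangent_space N x \<subseteq> tangent_space N' x"
  unfolding tangent_space_def
  by (intro Collect_mono ex_mono impI) (elim exE conjE, intro exI conjI; (assumption | erule subset_trans))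

text \<open>Reversing time swaps the two kinds of one-sided curves.\<close>

lemma tangent_space_uminus:
  assumes "u \<in> tangent_space N x"
  shows "- u \<in> tangent_space N x"
proof -
  obtain \<gamma> e I where e: "0 < (e::real)" "\<gamma> 0 = x" "I = {0..<e} \<or> I = {-e<..0}"
    "\<gamma> ` I \<subseteq> N" "(\<gamma> has_vector_derivative u) (at 0 within I)"
    using assms unfolding tangent_space_def by blast
  have img: "uminus ` (uminus ` I) = I"
    by (simp add: image_image)
  have "((\<gamma> \<circ> uminus) has_vector_derivative (- 1) *\<^sub>R u) (at 0 within uminus ` I)"
    by (rule vector_diff_chain_within)
       (use e(5) in \<open>auto intro!: derivative_eq_intros simp: img\<close>)
  moreover have "uminus ` I = {0..<e} \<or> uminus ` I = {-e<..0}"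
    using e(3) by auto
  moreover have "(\<gamma> \<circ> uminus) ` (uminus ` I) \<subseteq> N"
    using e(4) by auto
  moreover have "(\<gamma> \<circ> uminus) 0 = x" using e(2) by simp
  ultimately show ?thesis
    using e(1) by (intro tangent_spaceI[of e "\<gamma> \<circ> uminus" _ "uminus ` I"]) simp_all
qed

text \<open>
  Along a curve \<open>\<gamma>\<close> with velocity \<open>u\<close> at \<open>x\<close>, the direction of \<open>(\<gamma> t - x) / t\<close> tends to that of \<open>u\<close>,
  and it is a secant direction up to the sign of \<open>t\<close>.  The curve may exist on one side of
  \<open>0\<close> only, so the sign cannot be chosen; this is why both \<open>D\<close> and its negative occur.
\<close>

lemma tangent_direction_in_closure_secants:
  fixes N :: "'a::euclidean_space set"
  assumes u: "u \<in> tangent_space N x" "u \<noteq> 0" and r: "0 < r"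
  defines "D \<equiv> unit_directions ((\<lambda>c. x - c) ` (N \<inter> cball x r))"
  shows "sgn u \<in> closure (D \<union> uminus ` D)"
proof -
  obtain \<gamma> e I where e: "0 < (e::real)" "\<gamma> 0 = x" "I = {0..<e} \<or> I = {-e<..0}"
    "\<gamma> ` I \<subseteq> N" "(\<gamma> has_vector_derivative u) (at 0 within I)"
    using u unfolding tangent_space_def by blast
  let ?q = "\<lambda>t. (\<gamma> t - x) /\<^sub>R t"
  have q: "(?q \<longlongrightarrow> u) (at 0 within I)"
  proof -
    have "((\<lambda>t. (\<gamma> t - \<gamma> 0 - (t - 0) *\<^sub>R u) /\<^sub>R norm (t - 0)) \<longlongrightarrow> 0) (at 0 within I)"
      using e(5) unfolding has_vector_derivative_def has_derivative_within
      by (simp add: divide_inverse diff_diff_eq)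
    then have "((\<lambda>t. norm ((\<gamma> t - x - t *\<^sub>R u) /\<^sub>R \<bar>t\<bar>)) \<longlongrightarrow> 0) (at 0 within I)"
      using e(2) tendsto_norm_zero by fastforce
    moreover have "\<forall>\<^sub>F t in at 0 within I. norm ((\<gamma> t - x - t *\<^sub>R u) /\<^sub>R \<bar>t\<bar>) = norm (?q t - u)"
      unfolding eventually_at_filter
    proof (intro always_eventually allI impI)
      fix t :: real assume "t \<noteq> 0"
      then have "norm ((\<gamma> t - x - t *\<^sub>R u) /\<^sub>R \<bar>t\<bar>) = norm ((\<gamma> t - x - t *\<^sub>R u) /\<^sub>R t)"
        by simp
      also have "(\<gamma> t - x - t *\<^sub>R u) /\<^sub>R t = ?q t - u"
        using \<open>t \<noteq> 0\<close> by (simp add: scaleR_diff_right)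
      finally show "norm ((\<gamma> t - x - t *\<^sub>R u) /\<^sub>R \<bar>t\<bar>) = norm (?q t - u)" .
    qed
    ultimately have "((\<lambda>t. norm (?q t - u)) \<longlongrightarrow> 0) (at 0 within I)"
      using tendsto_cong by fast
    then show ?thesis
      using LIM_zero_cancel tendsto_norm_zero_iff by blast
  qed
  have s: "((\<lambda>t. sgn (?q t)) \<longlongrightarrow> sgn u) (at 0 within I)"
    by (rule tendsto_sgn[OF q u(2)])
  have g: "(\<gamma> \<longlongrightarrow> x) (at 0 within I)"
    using has_vector_derivative_continuous[OF e(5)] e(2) by (simp add: continuous_within)
  have "\<forall>\<^sub>F t in at 0 within I. sgn (?q t) \<in> D \<union> uminus ` D"
  proof -
    have "\<forall>\<^sub>F t in at 0 within I. dist (\<gamma> t) x < r"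
      using g r by (rule tendstoD)
    moreover have "\<forall>\<^sub>F t in at 0 within I. ?q t \<noteq> 0"
      using q u(2) by (rule tendsto_imp_eventually_ne)
    moreover have "\<forall>\<^sub>F t in at 0 within I. t \<in> I"
      by (simp add: eventually_at_filter)
    ultimately show ?thesis
    proof eventually_elim
      case (elim t)
      then have "\<gamma> t \<in> N \<inter> cball x r" "x - \<gamma> t \<noteq> 0"
        using e(4) by (auto simp: dist_commute)
      then have D: "sgn (x - \<gamma> t) \<in> D"
        unfolding D_def unit_directions_def by blast
      have "sgn (?q t) = sgn (inverse t) *\<^sub>R sgn (\<gamma> t - x)"
        by (rule sgn_scaleR)
      also have "sgn (\<gamma> t - x) = - sgn (x - \<gamma> t)"
        using sgn_minus[of "x - \<gamma> t"] by simp
      finally show ?case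
        using D elim(2) by (cases "t > 0") (auto simp: sgn_real_def)
    qed
  qed
  moreover have "at 0 within I \<noteq> bot"
  proof -
    have "{0..<e} - {0} = {0<..<e}" "{-e<..0} - {0} = {-e<..<0}" by auto
    then have "0 \<in> closure (I - {0})" using e(1,3) by (elim disjE) simp_all
    then show ?thesis by (simp add: at_within_eq_bot_iff)
  qed
  ultimately show ?thesis
    using s closure_subset[of "D \<union> uminus ` D"]
    by (intro Lim_in_closed_set[OF closed_closure _ _ s]) (auto elim!: eventually_mono simp del: closure_Un)
qed

text \<open>
  A chart \<open>\<Phi>\<close> maps the secants of \<open>N\<close> to secants of a linear subspace or half space, and by
  differentiability their rescaled limit is \<open>h = D\<Phi> d\<close>.  The ray from \<open>\<Phi> x\<close> in direction
  \<open>h\<close> stays in the flat model for a short time, and its preimage is a curve in \<open>N\<close> with velocity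
  \<open>D\<Psi> h = d\<close>.
\<close>

lemma secant_limit_in_tangent_space:
  fixes N :: "'a::euclidean_space set"
  assumes N: "embedded_submanifold N" and x: "x \<in> N"
    and c: "\<And>n. c n \<in> N" "\<And>n. c n \<noteq> x" "c \<longlonglongrightarrow> x" "(\<lambda>n. sgn (c n - x)) \<longlonglongrightarrow> d"
  shows "d \<in> tangent_space N x"
proof -
  obtain X W \<Phi> \<Psi> L where xX: "x \<in> X" and diff: "C1_diffeomorphism X W \<Phi> \<Psi>" and L: "subspace L"
    and cases: "\<Phi> ` (N \<inter> X) = W \<inter> L \<or>
      (\<exists>n\<in>L. n \<noteq> 0 \<and> \<Phi> ` (N \<inter> X) = W \<inter> {z \<in> L. 0 \<le> n \<bullet> z})"
    using N x unfolding embedded_submanifold_def by blast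
  \<comment> \<open>With \<open>n = 0\<close> the half space is all of \<open>L\<close>, so both kinds of chart have the same form.\<close>
  obtain n where flat: "\<Phi> ` (N \<inter> X) = W \<inter> {z \<in> L. 0 \<le> n \<bullet> z}"
  proof (cases "\<Phi> ` (N \<inter> X) = W \<inter> L")
    case True
    then show ?thesis using that[of 0] by simp
  qed (use cases that in blast)
  have op: "open X" "open W" and hom: "homeomorphism X W \<Phi> \<Psi>"
    and C1: "C1_on \<Phi> X" "C1_on \<Psi> W"
    using diff unfolding C1_diffeomorphism_def by auto
  define z where "z = \<Phi> x"
  have zW: "z \<in> W" using hom xX unfolding z_def homeomorphism_def by blast
  have \<Psi>z: "\<Psi> z = x" using homeomorphism_apply1[OF hom xX] by (simp add: z_def)
  obtain A where A: "(\<Phi> has_derivative A) (at x)"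
    using C1(1) xX unfolding C1_on_def by blast
  obtain B where B: "(\<Psi> has_derivative B) (at z)"
    using C1(2) zW unfolding C1_on_def by blast
  have linA: "bounded_linear A" using A has_derivative_bounded_linear by blast
  have BA: "B (A u) = u" for u
  proof -
    have "((\<Psi> \<circ> \<Phi>) has_derivative (B \<circ> A)) (at x)"
      using A B by (intro diff_chain_at) (auto simp: z_def)
    then have "(id has_derivative (B \<circ> A)) (at x)"
      by (rule has_derivative_transform_within_open[OF _ op(1) xX])
         (simp add: homeomorphism_apply1[OF hom])
    then have "B \<circ> A = id"
      using has_derivative_unique[OF _ has_derivative_id] by fastforce
    then show ?thesis by (simp add: fun_eq_iff)
  qed
  define h where "h = A d"
  let ?s = "\<lambda>n. (\<Phi> (c n) - z) /\<^sub>R norm (c n - x)"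
  have s: "?s \<longlonglongrightarrow> h"
  proof -
    have "((\<lambda>y. (\<Phi> y - \<Phi> x - A (y - x)) /\<^sub>R norm (y - x)) \<longlongrightarrow> 0) (at x)"
      using A unfolding has_derivative_def
      by (simp add: has_derivative_at divide_inverse)
    moreover have "filterlim c (at x) sequentially"
      using c(2,3) by (simp add: filterlim_at)
    ultimately have "(\<lambda>n. (\<Phi> (c n) - \<Phi> x - A (c n - x)) /\<^sub>R norm (c n - x)) \<longlonglongrightarrow> 0"
      by (rule filterlim_compose)
    moreover have "(\<lambda>n. A (sgn (c n - x))) \<longlonglongrightarrow> h"
      unfolding h_def by (rule bounded_linear.tendsto[OF linA c(4)])
    ultimately have "(\<lambda>n. (\<Phi> (c n) - \<Phi> x - A (c n - x)) /\<^sub>R norm (c n - x) + A (sgn (c n - x)))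
        \<longlonglongrightarrow> 0 + h"
      by (rule tendsto_add)
    moreover have "A (sgn y) = A y /\<^sub>R norm y" for y
      unfolding sgn_div_norm by (rule linear_cmul[OF bounded_linear.linear[OF linA]])
    ultimately show ?thesis
      by (simp add: z_def flip: scaleR_add_right)
  qed
  have ev: "\<forall>\<^sub>F k in sequentially. \<Phi> (c k) \<in> L \<and> 0 \<le> n \<bullet> \<Phi> (c k)"
  proof -
    have "\<forall>\<^sub>F k in sequentially. c k \<in> X"
      using c(3) op(1) xX by (rule topological_tendstoD)
    then show ?thesis
      by eventually_elim (use c(1) flat in blast)
  qed
  have zL: "z \<in> L" "0 \<le> n \<bullet> z"
    using flat x xX unfolding z_def by blast+
  have hL: "h \<in> L"
  proof (rule Lim_in_closed_set[OF closed_subspace[OF L] _ _ s])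
    show "\<forall>\<^sub>F k in sequentially. ?s k \<in> L"
      using ev by eventually_elim (use L zL in \<open>auto intro!: subspace_scale subspace_diff\<close>)
  qed simp
  \<comment> \<open>At a boundary point the limit velocity cannot leave the half space; at an interior point
    short segments in any direction stay inside.\<close>
  have half: "0 \<le> n \<bullet> h" if "n \<bullet> z = 0"
  proof (rule tendsto_lowerbound)
    show "(\<lambda>k. n \<bullet> ?s k) \<longlonglongrightarrow> n \<bullet> h" by (intro tendsto_intros s)
    show "\<forall>\<^sub>F k in sequentially. 0 \<le> n \<bullet> ?s k"
      using ev by eventually_elim (simp add: inner_diff_right that)
  qed simp
  have lim: "((\<lambda>t. z + t *\<^sub>R h) \<longlongrightarrow> z) (at_right 0)"
    by (rule tendsto_eq_intros refl | simp)+
  have "\<forall>\<^sub>F t in at_right 0. 0 \<le> n \<bullet> (z + t *\<^sub>R h)"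
  proof (cases "n \<bullet> z = 0")
    case True
    then show ?thesis
      using half eventually_at_right_less[of 0]
      by (auto simp: inner_add_right elim!: eventually_mono)
  next
    case False
    have "((\<lambda>t. n \<bullet> (z + t *\<^sub>R h)) \<longlongrightarrow> n \<bullet> z) (at_right 0)"
      by (intro tendsto_intros lim)
    then have "\<forall>\<^sub>F t in at_right 0. 0 < n \<bullet> (z + t *\<^sub>R h)"
      using False zL(2) by (intro order_tendstoD(1)) auto
    then show ?thesis by eventually_elim simp
  qed
  moreover have "\<forall>\<^sub>F t in at_right 0. z + t *\<^sub>R h \<in> W"
    using lim op(2) zW by (rule topological_tendstoD)
  ultimately have "\<forall>\<^sub>F t in at_right 0. \<Psi> (z + t *\<^sub>R h) \<in> N"
  proof eventually_elim
    case (elim t)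
    then have "z + t *\<^sub>R h \<in> \<Phi> ` (N \<inter> X)"
      unfolding flat using L zL hL by (auto intro: subspace_add subspace_scale)
    then show ?case using homeomorphism_apply1[OF hom] by auto
  qed
  then obtain e where e: "0 < e" "\<And>t. 0 < t \<Longrightarrow> t < e \<Longrightarrow> \<Psi> (z + t *\<^sub>R h) \<in> N"
    unfolding eventually_at_right_field by auto
  let ?\<gamma> = "\<lambda>t. \<Psi> (z + t *\<^sub>R h)"
  have "(?\<gamma> has_vector_derivative d) (at 0 within {0..<e})"
  proof -
    have "((\<lambda>t. z + t *\<^sub>R h) has_derivative (\<lambda>t. t *\<^sub>R h)) (at 0)"
      by (auto intro!: derivative_eq_intros)
    moreover have "(\<Psi> has_derivative B) (at (z + 0 *\<^sub>R h))" using B by simp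
    ultimately have "(?\<gamma> has_derivative (\<lambda>t. B (t *\<^sub>R h))) (at 0)"
      using diff_chain_at[of "\<lambda>t. z + t *\<^sub>R h" _ 0 \<Psi> B] by (simp add: o_def)
    moreover have "B (t *\<^sub>R h) = t *\<^sub>R d" for t
      using linear_cmul[OF has_derivative_linear[OF B]] BA by (simp add: h_def)
    ultimately show ?thesis
      unfolding has_vector_derivative_def by (simp add: has_derivative_at_withinI)
  qed
  moreover have "?\<gamma> ` {0..<e} \<subseteq> N"
  proof safe
    fix t assume "t \<in> {0..<e}"
    then show "?\<gamma> t \<in> N"
      using e(2)[of t] x \<Psi>z by (cases "t = 0") auto
  qed
  moreover have "?\<gamma> 0 = x" using \<Psi>z by simp
  ultimately show ?thesis
    using e(1) by (intro tangent_spaceI[of e ?\<gamma> _ "{0..<e}"]) simp_all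
qed

text \<open>
  Otherwise there are points tending to \<open>x\<close> whose secant directions all stay \<open>\<epsilon>\<close>-away from the unit
  tangent vectors; by compactness of the sphere a subsequence of these directions converges, and
  its limit is tangent, a contradiction.
\<close>

lemma secants_near_tangent_directions:
  fixes N :: "'a::euclidean_space set"
  assumes N: "embedded_submanifold (N \<inter> cball x r0)" and x: "x \<in> N" "0 < r0" and "0 < \<epsilon>"
  shows "\<forall>\<^sub>F r in at_right 0. \<forall>d \<in> unit_directions ((\<lambda>c. x - c) ` (N \<inter> cball x r)).
           \<exists>u \<in> unit_directions (tangent_space N x). dist d u \<le> \<epsilon>"
proof -
  let ?far = "\<lambda>c. c \<in> N \<and> c \<noteq> x \<and>
    (\<forall>u \<in> unit_directions (tangent_space N x). \<epsilon> < dist (sgn (x - c)) u)"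
  have "\<exists>r>0. \<forall>c. ?far c \<longrightarrow> r < dist x c"
  proof (rule ccontr)
    assume neg: "\<not> ?thesis"
    have "\<forall>n. \<exists>c. ?far c \<and> dist x c \<le> r0 * inverse (real (Suc n))"
    proof
      fix n
      have "0 < r0 * inverse (real (Suc n))" using x(2) by simp
      with neg show "\<exists>c. ?far c \<and> dist x c \<le> r0 * inverse (real (Suc n))"
        by (metis not_less)
    qed
    then obtain c where c: "\<And>n. ?far (c n)" "\<And>n. dist x (c n) \<le> r0 * inverse (real (Suc n))"
      by metis
    have "(\<lambda>n. r0 * inverse (real (Suc n))) \<longlonglongrightarrow> r0 * 0"
      by (intro tendsto_intros LIMSEQ_inverse_real_of_nat)
    then have bound_lim: "(\<lambda>n. r0 * inverse (real (Suc n))) \<longlonglongrightarrow> 0"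
      by (simp only: mult_zero_right)
    have bound: "\<forall>n. norm (dist (c n) x) \<le> r0 * inverse (real (Suc n))"
      using c(2) by (simp add: dist_commute)
    have "(\<lambda>n. dist (c n) x) \<longlonglongrightarrow> 0"
      by (rule Lim_null_comparison[OF always_eventually[OF bound] bound_lim])
    then have lim: "c \<longlonglongrightarrow> x" by (rule iffD2[OF tendsto_dist_iff])
    have ball: "c n \<in> N \<inter> cball x r0" for n
    proof -
      have "r0 * inverse (real (Suc n)) \<le> r0 * 1"
        using x(2) by (intro mult_left_mono) (auto simp: field_simps)
      then show ?thesis using c(1)[of n] c(2)[of n] by simp
    qed
    have "\<forall>n. sgn (c n - x) \<in> sphere 0 1"
      using c(1) by (auto simp: norm_sgn)
    then obtain d s where d: "d \<in> sphere 0 1" "strict_mono s" "((\<lambda>n. sgn (c n - x)) \<circ> s) \<longlonglongrightarrow> d"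
      by (rule seq_compactE[OF compact_imp_seq_compact[OF compact_sphere]])
    have "d \<in> tangent_space (N \<inter> cball x r0) x"
      using N
    proof (rule secant_limit_in_tangent_space[where c = "c \<circ> s"])
      show "(c \<circ> s) \<longlonglongrightarrow> x" using lim d(2) by (rule LIMSEQ_subseq_LIMSEQ)
    qed (use x ball c(1) d(3) in \<open>auto simp: o_def\<close>)
    then have "d \<in> tangent_space N x"
      using tangent_space_mono[of "N \<inter> cball x r0" N] by blast
    \<comment> \<open>The secants in question are \<open>x - c\<close>, opposite to the ones that converge to \<open>d\<close>.\<close>
    then have "- d \<in> tangent_space N x" by (rule tangent_space_uminus)
    moreover have "- d \<noteq> 0" "sgn (- d) = - d" using d(1) by (auto simp: sgn_div_norm)
    ultimately have "- d \<in> unit_directions (tangent_space N x)"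
      unfolding unit_directions_def by force
    then have far: "\<epsilon> < dist (sgn (x - c n)) (- d)" for n
      using c(1) by blast
    have "(\<lambda>n. dist (sgn (c (s n) - x)) d) \<longlonglongrightarrow> 0"
      using d(3) unfolding o_def by (rule iffD1[OF tendsto_dist_iff])
    then have "(\<lambda>n. dist (- sgn (c (s n) - x)) (- d)) \<longlonglongrightarrow> 0"
      by (simp only: dist_minus)
    moreover have "- sgn (c k - x) = sgn (x - c k)" for k
      using sgn_minus[of "x - c k"] by simp
    ultimately have "\<epsilon> \<le> 0"
      using far by (intro tendsto_lowerbound) (auto intro!: always_eventually less_imp_le)
    then show False using \<open>0 < \<epsilon>\<close> by simp
  qed
  then obtain r1 where r1: "0 < r1" "\<And>c. ?far c \<Longrightarrow> r1 < dist x c" by blast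
  have "\<forall>\<^sub>F r in at_right 0. r < r1"
    using r1(1) by (rule order_tendstoD(2)[OF tendsto_ident_at])
  then show ?thesis
  proof eventually_elim
    case (elim r)
    show ?case
    proof
      fix d assume "d \<in> unit_directions ((\<lambda>c. x - c) ` (N \<inter> cball x r))"
      then obtain c where "c \<in> N \<inter> cball x r" "x - c \<noteq> 0" "d = sgn (x - c)"
        unfolding unit_directions_def by blast
      then have c: "c \<in> N" "dist x c \<le> r" "c \<noteq> x" "d = sgn (x - c)" by simp_all
      have "\<not> ?far c" using r1(2)[of c] elim c(2) by linarith
      then show "\<exists>u \<in> unit_directions (tangent_space N x). dist d u \<le> \<epsilon>"
        using c(1,3) unfolding c(4) by (simp add: not_less)
    qed
  qed
qed


section \<open>Suprema of squared linear functionals\<close>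

definition sup_square :: "('a \<Rightarrow> real) \<Rightarrow> 'a set \<Rightarrow> ennreal" where
  "sup_square f D = (SUP d\<in>D. ennreal ((f d)\<^sup>2))"

lemma sup_square_finite:
  fixes f :: "'a::euclidean_space \<Rightarrow> real"
  assumes "linear f" and "\<And>d. d \<in> D \<Longrightarrow> norm d = 1"
  shows "sup_square f D < \<infinity>"
proof -
  have "bounded_linear f" using assms(1) by (simp add: linear_conv_bounded_linear)
  then obtain B where B: "\<And>d. norm (f d) \<le> norm d * B"
    using bounded_linear.bounded by blast
  have "(f d)\<^sup>2 \<le> B\<^sup>2" if "d \<in> D" for d
    using power_mono[of "\<bar>f d\<bar>" B 2] B[of d] assms(2)[OF that] by simp
  then have "sup_square f D \<le> ennreal (B\<^sup>2)"
    unfolding sup_square_def by (intro SUP_least ennreal_leI)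
  then show ?thesis by (rule order.strict_trans1) simp
qed

text \<open>A squared linear functional is even and continuous.\<close>

lemma sup_square_closure_mono:
  fixes f :: "'a::euclidean_space \<Rightarrow> real"
  assumes lin: "linear f" and D: "D \<subseteq> closure (D' \<union> uminus ` D')"
  shows "sup_square f D \<le> sup_square f D'"
  unfolding sup_square_def[of f D]
proof (rule SUP_least)
  fix d assume "d \<in> D"
  then have "d \<in> closure (D' \<union> uminus ` D')" using D by blast
  then obtain s where s: "\<And>n. s n \<in> D' \<union> uminus ` D'" "s \<longlonglongrightarrow> d"
    unfolding closure_sequential by metis
  have "(\<lambda>n. f (s n)) \<longlonglongrightarrow> f d"
    using s(2) lin linear_conv_bounded_linear bounded_linear.tendsto by blast
  then have lim: "(\<lambda>n. ennreal ((f (s n))\<^sup>2)) \<longlonglongrightarrow> ennreal ((f d)\<^sup>2)"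
    by (intro tendsto_ennrealI tendsto_power)
  have "ennreal ((f (s n))\<^sup>2) \<le> sup_square f D'" for n
  proof -
    obtain d' where "d' \<in> D'" "s n = d' \<or> s n = - d'" using s(1)[of n] by blast
    then have "d' \<in> D'" "(f (s n))\<^sup>2 = (f d')\<^sup>2" by (auto simp: linear_neg[OF lin])
    then show ?thesis unfolding sup_square_def by (auto intro: SUP_upper)
  qed
  then show "ennreal ((f d)\<^sup>2) \<le> sup_square f D'"
    by (intro LIMSEQ_le_const2[OF lim]) blast
qed

text \<open>The supremum may be taken over a countable dense subset of \<open>D\<close>, the same for every point.\<close>

lemma measurable_sup_square:
  fixes \<iota> :: "'a::euclidean_space \<Rightarrow> 'y \<Rightarrow> real"
  assumes lin: "\<And>y. y \<in> space \<rho> \<Longrightarrow> linear (\<lambda>c. \<iota> c y)"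
    and [measurable]: "\<And>c. \<iota> c \<in> borel_measurable \<rho>"
  shows "(\<lambda>y. sup_square (\<lambda>c. \<iota> c y) D) \<in> borel_measurable \<rho>"
proof -
  obtain D0 where D0: "countable D0" "D0 \<subseteq> D" "D \<subseteq> closure D0"
    using separable[of D] by blast
  have "sup_square (\<lambda>c. \<iota> c y) D = sup_square (\<lambda>c. \<iota> c y) D0" if "y \<in> space \<rho>" for y
  proof (rule antisym)
    show "sup_square (\<lambda>c. \<iota> c y) D \<le> sup_square (\<lambda>c. \<iota> c y) D0"
      using D0(3) closure_mono[of D0 "D0 \<union> uminus ` D0"]
      by (intro sup_square_closure_mono lin that) auto
    show "sup_square (\<lambda>c. \<iota> c y) D0 \<le> sup_square (\<lambda>c. \<iota> c y) D"
      unfolding sup_square_def using D0(2) by (rule SUP_subset_mono) simp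
  qed
  moreover have "(\<lambda>y. sup_square (\<lambda>c. \<iota> c y) D0) \<in> borel_measurable \<rho>"
    unfolding sup_square_def using D0(1) by (intro borel_measurable_SUP) auto
  ultimately show ?thesis by (subst measurable_cong) auto
qed

text \<open>
  The passage from pointwise bounds to \<^const>\<open>enn2real\<close> of the supremum.  The case \<open>\<omega> = 0\<close> is separate
  because the supremum may then be infinite.
\<close>

lemma weighted_sup_square_le:
  assumes "0 \<le> \<omega>" "0 \<le> B" and le: "\<And>d. d \<in> D \<Longrightarrow> \<omega> * (f d)\<^sup>2 \<le> B"
  shows "\<omega> * enn2real (sup_square f D) \<le> B"
proof (cases "\<omega> = 0")
  case False
  then have \<omega>: "0 < \<omega>" using assms(1) by simp
  have "sup_square f D \<le> ennreal (B / \<omega>)"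
    unfolding sup_square_def
    by (intro SUP_least ennreal_leI) (use le \<omega> in \<open>simp add: pos_le_divide_eq mult.commute\<close>)
  then have "enn2real (sup_square f D) \<le> B / \<omega>"
    using \<omega> assms(2) by (intro enn2real_leI) simp_all
  then show ?thesis using \<omega> by (simp add: pos_le_divide_eq mult.commute)
qed (use assms(2) in simp)

text \<open>
  One inequality between the suprema is monotonicity under closure.  The other one comes from
  \<open>(f d)\<^sup>2 - (f u)\<^sup>2 = f (d - u) f (d + u)\<close>, where \<open>d + u\<close> has norm at most 2; the weight is split
  evenly between the two factors.
\<close>

lemma weighted_sup_square_diff_le:
  fixes f :: "'a::euclidean_space \<Rightarrow> real"
  assumes lin: "linear f" and "0 \<le> \<omega>" "0 \<le> C" "0 \<le> \<epsilon>"
    and bound: "\<And>d. sqrt \<omega> * \<bar>f d\<bar> \<le> C * norm d"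
    and unit: "\<And>d. d \<in> D \<Longrightarrow> norm d = 1" "\<And>d. d \<in> D' \<Longrightarrow> norm d = 1"
    and dense: "D \<subseteq> closure (D' \<union> uminus ` D')"
    and near: "\<And>d. d \<in> D' \<Longrightarrow> \<exists>u\<in>D. dist d u \<le> \<epsilon>"
  shows "\<omega> * \<bar>enn2real (sup_square f D') - enn2real (sup_square f D)\<bar> \<le> 2 * C\<^sup>2 * \<epsilon>"
proof -
  let ?k = "enn2real (sup_square f D)"
  have fin: "sup_square f D < \<infinity>" "sup_square f D' < \<infinity>"
    using sup_square_finite[OF lin] unit by blast+
  have "?k \<le> enn2real (sup_square f D')"
    using fin sup_square_closure_mono[OF lin dense] by (intro enn2real_mono) auto
  moreover have "\<omega> * enn2real (sup_square f D') \<le> \<omega> * ?k + 2 * C\<^sup>2 * \<epsilon>"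
  proof (rule weighted_sup_square_le)
    fix d assume d: "d \<in> D'"
    then obtain u where u: "u \<in> D" "dist d u \<le> \<epsilon>" using near by blast
    have "ennreal ((f u)\<^sup>2) \<le> sup_square f D"
      unfolding sup_square_def using u(1) by (rule SUP_upper)
    then have "(f u)\<^sup>2 \<le> ?k"
      using enn2real_mono[of "ennreal ((f u)\<^sup>2)" "sup_square f D"] fin(1) by simp
    then have 1: "\<omega> * (f u)\<^sup>2 \<le> \<omega> * ?k" using \<open>0 \<le> \<omega>\<close> by (rule mult_left_mono)
    have "norm (d + u) \<le> 2"
      using norm_triangle_ineq[of d u] unit(1)[OF u(1)] unit(2)[OF d] by simp
    then have plus: "sqrt \<omega> * \<bar>f (d + u)\<bar> \<le> C * 2"
      using bound[of "d + u"] mult_left_mono[OF _ \<open>0 \<le> C\<close>] order.trans by blast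
    have minus: "sqrt \<omega> * \<bar>f (d - u)\<bar> \<le> C * \<epsilon>"
      using bound[of "d - u"] mult_left_mono[OF _ \<open>0 \<le> C\<close>] u(2) order.trans
      unfolding dist_norm by blast
    have 2: "(sqrt \<omega> * \<bar>f (d - u)\<bar>) * (sqrt \<omega> * \<bar>f (d + u)\<bar>) \<le> (C * \<epsilon>) * (C * 2)"
      by (rule mult_mono[OF minus plus]) (use assms(2-4) in simp_all)
    have "\<omega> * (f d)\<^sup>2 = \<omega> * (f u)\<^sup>2 + \<omega> * (f (d - u) * f (d + u))"
      by (simp add: linear_diff[OF lin] linear_add[OF lin] algebra_simps power2_eq_square)
    also have "\<omega> * (f (d - u) * f (d + u)) \<le> \<omega> * (\<bar>f (d - u)\<bar> * \<bar>f (d + u)\<bar>)"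
      using \<open>0 \<le> \<omega>\<close> by (intro mult_left_mono) (simp_all flip: abs_mult)
    also have "\<dots> = (sqrt \<omega> * sqrt \<omega>) * (\<bar>f (d - u)\<bar> * \<bar>f (d + u)\<bar>)"
      using \<open>0 \<le> \<omega>\<close> by simp
    also have "\<dots> = (sqrt \<omega> * \<bar>f (d - u)\<bar>) * (sqrt \<omega> * \<bar>f (d + u)\<bar>)"
      by (simp only: ac_simps)
    also note 2
    finally show "\<omega> * (f d)\<^sup>2 \<le> \<omega> * ?k + 2 * C\<^sup>2 * \<epsilon>"
      using 1 by (simp add: power2_eq_square ac_simps)
  qed (use assms(2-4) in simp_all)
  ultimately show ?thesis by (simp add: algebra_simps)
qed


section \<open>Variation functions in coordinates\<close>

text \<open>
  Each \<open>\<iota> d\<close> has its own exceptional null set.  Bounding the finitely many basis vectors first gives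
  one null set that serves all \<open>d\<close>, as is needed for a supremum over uncountably many directions.
\<close>

lemma L2_embedding_weighted_bound:
  fixes \<iota> :: "'e::euclidean_space \<Rightarrow> 'y \<Rightarrow> real"
  assumes w: "weight_function \<rho> w" and emb: "L2_embedding \<rho> w \<iota>"
  obtains C where "0 \<le> C" "AE y in \<rho>. \<forall>d. sqrt (w y) * \<bar>\<iota> d y\<bar> \<le> C * norm d"
proof -
  have lin: "\<And>y. y \<in> space \<rho> \<Longrightarrow> linear (\<lambda>c. \<iota> c y)"
    and mem: "\<And>c. \<iota> c \<in> L2_wsup \<rho> w"
    using emb unfolding L2_embedding_def by auto
  define B where "B b = enn2real (wsup_norm \<rho> w (\<iota> b))" for b
  have "AE y in \<rho>. sqrt (w y) * \<bar>\<iota> b y\<bar> \<le> B b" for b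
  proof -
    have "wsup_norm \<rho> w (\<iota> b) = ennreal (B b)"
      using mem[of b] by (simp add: L2_wsup_def B_def)
    then have "AE y in \<rho>. ennreal (sqrt (w y) * \<bar>\<iota> b y\<bar>) \<le> ennreal (B b)"
      using esssup_AE[of "\<lambda>y. ennreal (sqrt (w y) * \<bar>\<iota> b y\<bar>)" \<rho>] by (simp add: wsup_norm_def)
    then show ?thesis by (simp add: ennreal_le_iff B_def)
  qed
  then have "AE y in \<rho>. \<forall>b\<in>Basis. sqrt (w y) * \<bar>\<iota> b y\<bar> \<le> B b"
    by (intro AE_finite_allI) auto
  then have "AE y in \<rho>. \<forall>d. sqrt (w y) * \<bar>\<iota> d y\<bar> \<le> (\<Sum>b\<in>Basis. B b) * norm d"
    using AE_space
  proof eventually_elim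
    case (elim y)
    have "sqrt (w y) * \<bar>\<iota> d y\<bar> \<le> (\<Sum>b\<in>Basis. B b) * norm d" for d
    proof -
      have w0: "0 \<le> w y" using w elim(2) unfolding weight_function_def by blast
      have "\<iota> d y = (\<Sum>b\<in>Basis. (d \<bullet> b) * \<iota> b y)"
        using linear_sum[OF lin[OF elim(2)], of "\<lambda>b. (d \<bullet> b) *\<^sub>R b" Basis]
        by (simp add: linear_cmul[OF lin[OF elim(2)]] euclidean_representation)
      then have "sqrt (w y) * \<bar>\<iota> d y\<bar> \<le> sqrt (w y) * (\<Sum>b\<in>Basis. \<bar>(d \<bullet> b) * \<iota> b y\<bar>)"
        using w0 by (simp add: mult_left_mono sum_abs)
      also have "\<dots> = (\<Sum>b\<in>Basis. (sqrt (w y) * \<bar>\<iota> b y\<bar>) * \<bar>d \<bullet> b\<bar>)"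
        by (simp add: sum_distrib_left abs_mult ac_simps)
      also have "\<dots> \<le> (\<Sum>b\<in>Basis. B b * norm d)"
        using elim(1) w0 by (intro sum_mono mult_mono) (simp_all add: Basis_le_norm B_def)
      finally show ?thesis by (simp add: sum_distrib_right)
    qed
    then show ?case by blast
  qed
  moreover have "0 \<le> (\<Sum>b\<in>Basis. B b)" by (simp add: B_def sum_nonneg)
  ultimately show ?thesis by (rule that[rotated])
qed

lemma L2_norm_cong:
  "(\<And>y. y \<in> space \<rho> \<Longrightarrow> f y = g y) \<Longrightarrow> L2_norm \<rho> f = L2_norm \<rho> g"
  unfolding L2_norm_def by (simp cong: Bochner_Integration.integral_cong)

text \<open>
  The identity is required on the space of the measure only, since \<open>\<iota>\<close> is linear only there.  The
  family \<open>f\<close> is general so that it covers both the tangent space and the differences \<open>v - x\<close>, which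
  need not be literally in the range of \<open>\<iota>\<close>.
\<close>

lemma variation_in_coordinates:
  fixes \<iota> :: "'e::euclidean_space \<Rightarrow> 'y \<Rightarrow> real"
  assumes emb: "L2_embedding \<rho> w \<iota>"
    and f: "\<And>s y. s \<in> S \<Longrightarrow> y \<in> space \<rho> \<Longrightarrow> f s y = \<iota> (g s) y"
    and y: "y \<in> space \<rho>"
  shows "variation \<rho> (f ` S) y = sup_square (\<lambda>d. \<iota> d y) (unit_directions (g ` S))"
proof -
  have lin: "linear (\<lambda>c. \<iota> c y)" and norm: "\<And>c. L2_norm \<rho> (\<iota> c) = norm c"
    using emb y unfolding L2_embedding_def by auto
  have fn: "L2_norm \<rho> (f s) = norm (g s)" if "s \<in> S" for s
    using L2_norm_cong[of \<rho> "f s" "\<iota> (g s)"] f[OF that] norm by simp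
  let ?S = "{s \<in> S. g s \<noteq> 0}"
  have "normalized \<rho> (f ` S) = (\<lambda>s y. f s y / L2_norm \<rho> (f s)) ` ?S"
    unfolding normalized_def using fn by fastforce
  then have "variation \<rho> (f ` S) y = (SUP s\<in>?S. ennreal (\<bar>f s y / L2_norm \<rho> (f s)\<bar>\<^sup>2))"
    unfolding variation_def by (simp only: image_image)
  also have "\<dots> = (SUP s\<in>?S. ennreal ((\<iota> (sgn (g s)) y)\<^sup>2))"
  proof (rule SUP_cong)
    fix s assume s: "s \<in> ?S"
    have "\<iota> (sgn (g s)) y = \<iota> (g s) y / norm (g s)"
      using linear_cmul[OF lin] by (simp add: sgn_div_norm divide_inverse mult.commute)
    then have "f s y / L2_norm \<rho> (f s) = \<iota> (sgn (g s)) y"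
      using s f y fn by simp
    then show "ennreal (\<bar>f s y / L2_norm \<rho> (f s)\<bar>\<^sup>2) = ennreal ((\<iota> (sgn (g s)) y)\<^sup>2)"
      by (simp only: power2_abs)
  qed simp
  also have "\<dots> = sup_square (\<lambda>d. \<iota> d y) ((\<lambda>s. sgn (g s)) ` ?S)"
    by (simp add: sup_square_def image_image)
  also have "(\<lambda>s. sgn (g s)) ` ?S = unit_directions (g ` S)"
    unfolding unit_directions_def by auto
  finally show ?thesis .
qed

lemma wsup_norm_le:
  assumes w: "weight_function \<rho> w" and [measurable]: "f \<in> borel_measurable \<rho>"
    and le: "AE y in \<rho>. w y * \<bar>f y\<bar> \<le> B"
  shows "wsup_norm \<rho> (\<lambda>y. (w y)\<^sup>2) f \<le> ennreal B"
  unfolding wsup_norm_def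
proof (rule esssup_I)
  have [measurable]: "w \<in> borel_measurable \<rho>"
    using w unfolding weight_function_def by blast
  show "(\<lambda>y. ennreal (sqrt ((w y)\<^sup>2) * \<bar>f y\<bar>)) \<in> borel_measurable \<rho>" by measurable
  show "AE y in \<rho>. ennreal (sqrt ((w y)\<^sup>2) * \<bar>f y\<bar>) \<le> ennreal B"
    using le AE_space
    by eventually_elim (use w in \<open>simp add: weight_function_def ennreal_leI\<close>)
qed

lemma in_wsup2_sup_square:
  fixes \<iota> :: "'e::euclidean_space \<Rightarrow> 'y \<Rightarrow> real"
  assumes w: "weight_function \<rho> w" and emb: "L2_embedding \<rho> w \<iota>"
    and unit: "\<And>d. d \<in> D \<Longrightarrow> norm d = 1"
    and K: "\<And>y. y \<in> space \<rho> \<Longrightarrow> K y = sup_square (\<lambda>d. \<iota> d y) D"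
  shows "in_wsup2 \<rho> w K"
proof -
  have lin: "\<And>y. y \<in> space \<rho> \<Longrightarrow> linear (\<lambda>c. \<iota> c y)"
    and meas: "\<And>c. \<iota> c \<in> borel_measurable \<rho>"
    using emb unfolding L2_embedding_def L2_wsup_def L2_def by auto
  have w0: "\<And>y. y \<in> space \<rho> \<Longrightarrow> 0 \<le> w y"
    using w unfolding weight_function_def by auto
  have [measurable]: "K \<in> borel_measurable \<rho>"
    using measurable_sup_square[OF lin meas] K by (subst measurable_cong) auto
  have "AE y in \<rho>. K y < \<infinity>"
    using sup_square_finite[OF lin unit] K by (intro AE_I2) simp
  moreover have "wsup_norm \<rho> (\<lambda>y. (w y)\<^sup>2) (\<lambda>y. enn2real (K y)) < \<infinity>"
  proof -
    obtain C where C: "0 \<le> C" "AE y in \<rho>. \<forall>d. sqrt (w y) * \<bar>\<iota> d y\<bar> \<le> C * norm d"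
      using L2_embedding_weighted_bound[OF w emb] by blast
    have "AE y in \<rho>. w y * \<bar>enn2real (K y)\<bar> \<le> C\<^sup>2"
      using C(2) AE_space
    proof eventually_elim
      case (elim y)
      have "w y * (\<iota> d y)\<^sup>2 \<le> C\<^sup>2" if "d \<in> D" for d
      proof -
        have "(sqrt (w y) * \<bar>\<iota> d y\<bar>)\<^sup>2 \<le> C\<^sup>2"
          using elim unit[OF that] w0 by (intro power_mono) (auto dest: spec[of _ d])
        then show ?thesis using w0 elim(2) by (simp add: power_mult_distrib)
      qed
      then have "w y * enn2real (K y) \<le> C\<^sup>2"
        unfolding K[OF elim(2)] by (intro weighted_sup_square_le w0 elim(2)) auto
      then show ?case by simp
    qed
    then have "wsup_norm \<rho> (\<lambda>y. (w y)\<^sup>2) (\<lambda>y. enn2real (K y)) \<le> ennreal (C\<^sup>2)"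
      by (intro wsup_norm_le[OF w]) simp_all
    then show ?thesis by (rule order.strict_trans1) simp
  qed
  ultimately show ?thesis unfolding in_wsup2_def by simp
qed

section \<open>The local variation function\<close>

theorem corollary3p10:
  fixes \<rho> :: "'y measure" and w :: "'y \<Rightarrow> real"
    and \<iota> :: "'e::euclidean_space \<Rightarrow> 'y \<Rightarrow> real"
    and M :: "('y \<Rightarrow> real) set" and v :: "'y \<Rightarrow> real"
  assumes "prob_space \<rho>"
    and "weight_function \<rho> w"
    and "M \<subseteq> L2 \<rho>"
    and "v \<in> M"
    and "locally_linearizable \<rho> w \<iota> M v"
  shows "has_local_variation \<rho> w M v (variation \<rho> (model_tangent_space \<iota> M v))"
proof -
  have emb: "L2_embedding \<rho> w \<iota>"
    and loc: "\<forall>\<^sub>F r in at_right 0. model_ball \<rho> M v r \<subseteq> range \<iota> \<and>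
      embedded_submanifold (\<iota> -` model_ball \<rho> M v r)"
    using assms(5) unfolding locally_linearizable_def by (auto elim: eventually_mono)
  have lin: "\<And>y. y \<in> space \<rho> \<Longrightarrow> linear (\<lambda>c. \<iota> c y)"
    and norm: "\<And>c. L2_norm \<rho> (\<iota> c) = norm c"
    using emb unfolding L2_embedding_def by auto
  have w0: "\<And>y. y \<in> space \<rho> \<Longrightarrow> 0 \<le> w y"
    using assms(2) unfolding weight_function_def by auto
  have dist: "L2_norm \<rho> (\<lambda>y. \<iota> c y - \<iota> c' y) = dist c c'" for c c'
    using L2_norm_cong[of \<rho> "\<lambda>y. \<iota> c y - \<iota> c' y" "\<iota> (c - c')"] norm
    by (simp add: linear_diff[OF lin] dist_norm)
  have "inj \<iota>"
  proof (rule injI)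
    fix c c' assume "\<iota> c = \<iota> c'"
    then show "c = c'" using dist[of c c'] by (simp add: L2_norm_def)
  qed
  obtain r0 where r0: "0 < r0"
    "\<And>r. 0 < r \<Longrightarrow> r \<le> r0 \<Longrightarrow> model_ball \<rho> M v r \<subseteq> range \<iota> \<and>
      embedded_submanifold (\<iota> -` model_ball \<rho> M v r)"
  proof -
    obtain b where "0 < b" "\<And>r. 0 < r \<Longrightarrow> r < b \<Longrightarrow> model_ball \<rho> M v r \<subseteq> range \<iota> \<and>
        embedded_submanifold (\<iota> -` model_ball \<rho> M v r)"
      using loc unfolding eventually_at_right_field by auto
    then show ?thesis by (intro that[of "b / 2"]) auto
  qed
  have "v \<in> model_ball \<rho> M v r0"
    using assms(4) r0(1) by (simp add: model_ball_def L2_norm_def)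
  then obtain c0 where c0: "v = \<iota> c0" using r0 by blast
  define N where "N = \<iota> -` M"
  define T where "T = unit_directions (tangent_space N c0)"
  define D where "D r = unit_directions ((\<lambda>c. c0 - c) ` (N \<inter> cball c0 r))" for r
  define K where "K = variation \<rho> (model_tangent_space \<iota> M v)"
  have ball: "\<iota> -` model_ball \<rho> M v r = N \<inter> cball c0 r" for r
    by (auto simp: model_ball_def N_def c0 dist)
  have c0N: "c0 \<in> N" using assms(4) by (simp add: N_def c0)
  have mfd: "embedded_submanifold (N \<inter> cball c0 r0)"
    using r0(2)[of r0] r0(1) ball by simp
  have small: "\<forall>\<^sub>F r in at_right 0. 0 < r \<and> r \<le> r0"
    using r0(1) unfolding eventually_at_right_field by (intro exI[of _ r0]) auto
  have K: "K y = sup_square (\<lambda>d. \<iota> d y) T" if "y \<in> space \<rho>" for y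
  proof -
    have "inv \<iota> v = c0" using \<open>inj \<iota>\<close> by (simp add: c0)
    then have "model_tangent_space \<iota> M v = \<iota> ` tangent_space N c0"
      by (simp add: model_tangent_space_def N_def)
    then show ?thesis
      using variation_in_coordinates[OF emb, where f = \<iota> and g = "\<lambda>s. s"] that
      by (simp add: K_def T_def)
  qed
  have Kr: "ball_variation \<rho> M v r y = sup_square (\<lambda>d. \<iota> d y) (D r)"
    if "y \<in> space \<rho>" "0 < r" "r \<le> r0" for r y
  proof -
    have "model_ball \<rho> M v r = \<iota> ` (N \<inter> cball c0 r)"
      using r0(2)[OF that(2,3)] unfolding ball[symmetric] by blast
    then have "(\<lambda>x y. v y - x y) ` model_ball \<rho> M v r
        = (\<lambda>c y. v y - \<iota> c y) ` (N \<inter> cball c0 r)"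
      by (simp add: image_image)
    then show ?thesis
      unfolding ball_variation_def D_def
      using that(1) by (simp add: variation_in_coordinates[OF emb, where g = "\<lambda>c. c0 - c"]
          c0 linear_diff[OF lin])
  qed
  have unit: "d \<in> T \<Longrightarrow> norm d = 1" "d \<in> D r \<Longrightarrow> norm d = 1" for d r
    unfolding T_def D_def by (fact norm_unit_directions)+
  have K_in: "in_wsup2 \<rho> w K"
    using in_wsup2_sup_square[OF assms(2) emb _ K] unit by blast
  have Kr_in: "in_wsup2 \<rho> w (ball_variation \<rho> M v r)" if "0 < r" "r \<le> r0" for r
    using in_wsup2_sup_square[OF assms(2) emb _ Kr] unit that by blast
  have T_dense: "T \<subseteq> closure (D r \<union> uminus ` D r)" if "0 < r" for r
    using tangent_direction_in_closure_secants that
    unfolding T_def D_def unit_directions_def[of "tangent_space N c0"] by blast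
  obtain C where C: "0 \<le> C" "AE y in \<rho>. \<forall>d. sqrt (w y) * \<bar>\<iota> d y\<bar> \<le> C * norm d"
    using L2_embedding_weighted_bound[OF assms(2) emb] by blast
  have le: "\<forall>\<^sub>F r in at_right 0. wsup_norm \<rho> (\<lambda>y. (w y)\<^sup>2)
      (\<lambda>y. enn2real (ball_variation \<rho> M v r y) - enn2real (K y)) \<le> ennreal (2 * C\<^sup>2 * \<epsilon>)"
    if "0 < \<epsilon>" for \<epsilon>
    using secants_near_tangent_directions[OF mfd c0N r0(1) that] small
  proof eventually_elim
    case (elim r)
    then have near: "\<exists>u\<in>T. dist d u \<le> \<epsilon>" if "d \<in> D r" for d
      using that unfolding D_def T_def by blast
    have "AE y in \<rho>. w y * \<bar>enn2real (ball_variation \<rho> M v r y) - enn2real (K y)\<bar>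
        \<le> 2 * C\<^sup>2 * \<epsilon>"
      using C(2) AE_space
    proof eventually_elim
      case (elim y)
      show ?case
        unfolding K[OF elim(2)] Kr[OF elim(2) \<open>0 < r \<and> r \<le> r0\<close>[THEN conjunct1]
            \<open>0 < r \<and> r \<le> r0\<close>[THEN conjunct2]]
        using elim(1) near T_dense \<open>0 < r \<and> r \<le> r0\<close> \<open>0 < \<epsilon>\<close> C(1)
        by (intro weighted_sup_square_diff_le[OF lin[OF elim(2)] w0[OF elim(2)] _ _ _ unit]) simp_all
    qed
    moreover have "K \<in> borel_measurable \<rho>"
        "ball_variation \<rho> M v r \<in> borel_measurable \<rho>"
      using K_in Kr_in elim(2) unfolding in_wsup2_def by auto
    ultimately show ?case
      by (intro wsup_norm_le[OF assms(2)] borel_measurable_diff borel_measurable_enn2real)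
  qed
  have "((\<lambda>r. wsup_norm \<rho> (\<lambda>y. (w y)\<^sup>2)
      (\<lambda>y. enn2real (ball_variation \<rho> M v r y) - enn2real (K y))) \<longlongrightarrow> 0) (at_right 0)"
  proof (rule order_tendstoI)
    fix a :: ennreal assume "0 < a"
    then obtain e where e: "0 < e" "ennreal e < a"
    proof -
      obtain b where b: "0 < b" "b < a" using dense[OF \<open>0 < a\<close>] by blast
      then have "b < top" using less_le_trans top_greatest by blast
      then show ?thesis using b by (intro that[of "enn2real b"]) (simp_all add: enn2real_positive_iff)
    qed
    \<comment> \<open>The summand 1 keeps the denominator positive when \<open>C = 0\<close>.\<close>
    have "2 * C\<^sup>2 * (e / (2 * C\<^sup>2 + 1)) \<le> e"
      using e(1) by (simp add: field_simps add_pos_nonneg)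
    then have "ennreal (2 * C\<^sup>2 * (e / (2 * C\<^sup>2 + 1))) < a"
      using e(2) ennreal_leI order.strict_trans1 by blast
    moreover have "0 < e / (2 * C\<^sup>2 + 1)"
      using e(1) by (simp add: add_nonneg_pos)
    ultimately show "\<forall>\<^sub>F r in at_right 0. wsup_norm \<rho> (\<lambda>y. (w y)\<^sup>2)
        (\<lambda>y. enn2real (ball_variation \<rho> M v r y) - enn2real (K y)) < a"
      using le[of "e / (2 * C\<^sup>2 + 1)"] by (auto elim!: eventually_mono)
  qed simp
  then show ?thesis
    unfolding has_local_variation_def K_def[symmetric]
    using K_in Kr_in small by (auto elim: eventually_mono)
qed

end
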